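(* Let $W_n$ be the squared cycle graph on $n$ vertices. Then the $3$-total cut complex satisfies \[ \Delta_3^t(W_n)\simeq \begin{cases} \mathbb{S}^{2n-17}, & n=9,10,\\ \mathbb{S}^{n-6}, & n\ge 11,\end{cases} \] where $\simeq$ denotes homotopy equivalence and $\mathbb{S}^d$ is the $d$-dimensional sphere.
   Context: The squared cycle graph $W_n$ is the graph with vertex set $[n]=\{1,\dots,n\}$ and edge set $\{\{i,i+1 \bmod n\},\{i,i+2 \bmod n\} : i=1,\dots,n\}$. For a graph $G=(V,E)$ and $k\ge 1$, the $k$-total cut complex $\Delta_k^t(G)$ is the simplicial complex on $V$ whose facets are the complements $V\setminus S$ of independent sets $S$ of $G$ with $|S|=k$; equivalently, $\sigma\subseteq V$ is a face iff $V\setminus\sigma$ contains an independent set of size $k$. *)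

theory Defs
  imports "HOL-Analysis.Analysis"
begin

definition csucc :: "nat \<Rightarrow> nat \<Rightarrow> nat" where
  "csucc n i = i mod n + 1"

definition sq_cycle_edges :: "nat \<Rightarrow> nat set set" where
  "sq_cycle_edges n =
     {{i, csucc n i} | i. i \<in> {1..n}} \<union> {{i, csucc n (csucc n i)} | i. i \<in> {1..n}}"

definition independent_set :: "'a set \<Rightarrow> 'a set set \<Rightarrow> 'a set \<Rightarrow> bool" where
  "independent_set V E S \<longleftrightarrow> S \<subseteq> V \<and> (\<forall>e\<in>E. \<not> e \<subseteq> S)"

definition total_cut_complex :: "nat \<Rightarrow> 'a set \<Rightarrow> 'a set set \<Rightarrow> 'a set set" where
  "total_cut_complex k V E =
     {\<sigma>. \<sigma> \<subseteq> V \<and> (\<exists>S. S \<subseteq> V - \<sigma> \<and> card S = k \<and> independent_set V E S)}"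

text \<open>Geometric realization of a (finite) simplicial complex K on vertices in nat,
  as a subspace of the product topology on nat => real: nonnegative barycentric
  coordinates with finite support forming a face of K, summing to 1.\<close>
definition geom_realization :: "nat set set \<Rightarrow> (nat \<Rightarrow> real) topology" where
  "geom_realization K = subtopology (powertop_real UNIV)
     {f. (\<forall>i. 0 \<le> f i) \<and> finite {i. f i \<noteq> 0} \<and> {i. f i \<noteq> 0} \<in> K
         \<and> (\<Sum>i\<in>{i. f i \<noteq> 0}. f i) = 1}"

end

theory Submission
  imports Defs
begin

text \<open>
  For a family \<open>H\<close> of subsets of \<open>V\<close> consider the complex of all \<open>\<sigma> \<subseteq> V\<close> disjoint from some member
  of \<open>H\<close>; the total cut complex is the case where \<open>H\<close> consists of the independent triples.
  Adding a hyperedge \<open>h\<close> to \<open>H\<close> preserves the homotopy type whenever some vertex \<open>w \<notin> h\<close> is such that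
  each \<open>e \<in> H\<close> through \<open>w\<close> can be replaced by an \<open>f \<in> H\<close> inside \<open>h \<union> (e - {w})\<close>, because the new
  faces are then matched by toggling \<open>w\<close> and can be collapsed.
  For \<open>n \<ge> 11\<close> this allows one to remove the chords \<open>{w - 1, w + 1}\<close> of \<open>W\<^sub>n\<close> one by one (with apex the
  midpoint \<open>w\<close>), reaching the cycle \<open>C\<^sub>n\<close>, and then to shorten the cycle by trading a vertex \<open>m\<close> for the
  hyperedge \<open>{m}\<close>, down to \<open>C\<^sub>6\<close>. There \<open>H\<close> has become a partition of \<open>V\<close> into \<open>n - 4\<close> blocks, and for
  a partition into \<open>p + 2\<close> blocks the complex collapses to the boundary of a simplex on \<open>p + 2\<close>
  representatives, a \<open>p\<close>-sphere. For \<open>n = 9\<close> the triples already form a partition into three blocks, and for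
  \<open>n = 10\<close> they can be traded for a partition into five pairs.
\<close>

subsection \<open>Collapses of geometric realizations\<close>

text \<open>The support of a point is a face and so lies in the finite set \<open>V\<close>. Summing
  over the fixed set \<open>V\<close> instead of the varying support makes the total mass easy to
  track along a deformation.\<close>

lemma geom_realization_on:
  assumes "finite V" "K \<subseteq> Pow V"
  shows "geom_realization K = subtopology (powertop_real UNIV)
    {f. (\<forall>i. 0 \<le> f i) \<and> {i. f i \<noteq> 0} \<in> K \<and> (\<Sum>i\<in>V. f i) = 1}"
proof -
  have "finite {i. f i \<noteq> 0} \<and> (\<Sum>i\<in>{i. f i \<noteq> 0}. f i) = (\<Sum>i\<in>V. f i)"
    if "{i. f i \<noteq> 0} \<in> K" for f :: "nat \<Rightarrow> real"
  proof -
    have "{i. f i \<noteq> 0} \<subseteq> V" using that assms by auto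
    then show ?thesis
      using assms(1) by (auto intro: finite_subset intro!: sum.mono_neutral_left)
  qed
  then have "{f. (\<forall>i. 0 \<le> f i) \<and> finite {i. f i \<noteq> 0} \<and> {i. f i \<noteq> 0} \<in> K
         \<and> (\<Sum>i\<in>{i. f i \<noteq> 0}. f i) = (1::real)} =
        {f. (\<forall>i. 0 \<le> f i) \<and> {i. f i \<noteq> 0} \<in> K \<and> (\<Sum>i\<in>V. f i) = 1}"
    by fastforce
  then show ?thesis by (simp add: geom_realization_def)
qed

lemma continuous_map_Min:
  fixes f :: "'a \<Rightarrow> 'b \<Rightarrow> real"
  assumes "finite I" "I \<noteq> {}" "\<And>i. i \<in> I \<Longrightarrow> continuous_map X euclideanreal (\<lambda>x. f x i)"
  shows "continuous_map X euclideanreal (\<lambda>x. Min (f x ` I))"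
  using assms
proof (induction I rule: finite_ne_induct)
  case (insert i F)
  then show ?case by (simp add: continuous_map_real_min)
qed simp

text \<open>The deformation moves the mass \<open>min {f i | i \<in> \<tau>}\<close> from each vertex of \<open>\<tau>\<close> to \<open>w\<close>.\<close>

lemma collapse_cone_link:
  assumes V: "finite V" "K \<subseteq> Pow V"
    and down: "\<And>\<sigma> \<rho>. \<sigma> \<in> K \<Longrightarrow> \<rho> \<subseteq> \<sigma> \<Longrightarrow> \<rho> \<in> K"
    and \<tau>: "\<tau> \<noteq> {}" "\<tau> \<subseteq> V" and w: "w \<in> V" "w \<notin> \<tau>"
    and cone: "\<And>\<sigma>. \<sigma> \<in> K \<Longrightarrow> \<tau> \<subseteq> \<sigma> \<Longrightarrow> insert w \<sigma> \<in> K"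
  shows "geom_realization K homotopy_equivalent_space geom_realization {\<sigma>\<in>K. \<not> \<tau> \<subseteq> \<sigma>}"
proof -
  define P where "P = (powertop_real UNIV :: (nat \<Rightarrow> real) topology)"
  define SK where "SK = {f. (\<forall>i. 0 \<le> f i) \<and> {i. f i \<noteq> 0} \<in> K \<and> (\<Sum>i\<in>V. f i) = (1::real)}"
  define SL where "SL = {f. (\<forall>i. 0 \<le> f i) \<and> {i. f i \<noteq> 0} \<in> {\<sigma>\<in>K. \<not> \<tau> \<subseteq> \<sigma>} \<and> (\<Sum>i\<in>V. f i) = (1::real)}"
  have RK: "geom_realization K = subtopology P SK"
    using geom_realization_on[OF V] by (simp add: P_def SK_def)
  have RL: "geom_realization {\<sigma>\<in>K. \<not> \<tau> \<subseteq> \<sigma>} = subtopology P SL"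
    unfolding SL_def P_def using V by (intro geom_realization_on) auto
  have fin: "finite \<tau>" using V \<tau> finite_subset by blast
  define m where "m = (\<lambda>f::nat \<Rightarrow> real. Min (f ` \<tau>))"
  define h where "h = (\<lambda>(t::real, f::nat \<Rightarrow> real) i.
     f i - t * (if i \<in> \<tau> then 1 else 0) * m f + t * (if i = w then real (card \<tau>) else 0) * m f)"
  have m_le: "m f \<le> f i" if "i \<in> \<tau>" for f i
    using fin that by (simp add: m_def)
  have m_ge: "0 \<le> m f" if "\<And>i. 0 \<le> f i" for f
    using fin \<tau> that by (auto simp: m_def)
  have m_0: "m f = 0" if "\<And>i. 0 \<le> f i" "i \<in> \<tau>" "f i = 0" for f i
    using m_ge[of f] m_le[of i f] that by fastforce
  have h_m0: "h (t, f) = f" if "m f = 0" for t f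
    using that by (auto simp: h_def)
  have sumh: "(\<Sum>i\<in>V. h (t, f) i) = (\<Sum>i\<in>V. f i)" for t f
  proof -
    have "(\<Sum>i\<in>V. h (t, f) i) = (\<Sum>i\<in>V. f i) - t * m f * (\<Sum>i\<in>V. if i \<in> \<tau> then 1 else 0)
        + t * m f * (\<Sum>i\<in>V. if i = w then real (card \<tau>) else 0)"
      by (simp add: h_def sum.distrib sum_subtractf sum_distrib_left algebra_simps)
    also have "(\<Sum>i\<in>V. if i \<in> \<tau> then 1 else (0::real)) = real (card \<tau>)"
      using V \<tau> by (simp add: sum.If_cases Int_absorb1)
    also have "(\<Sum>i\<in>V. if i = w then real (card \<tau>) else 0) = real (card \<tau>)"
      using V w by simp
    finally show ?thesis by simp
  qed
  have hK: "h (t, f) \<in> SK" if "f \<in> SK" "0 \<le> t" "t \<le> 1" for t f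
  proof (cases "\<tau> \<subseteq> {i. f i \<noteq> 0}")
    case False
    then show ?thesis using m_0[of f] that by (auto simp: SK_def h_m0)
  next
    case True
    have f0: "\<And>i. 0 \<le> f i" and fK: "{i. f i \<noteq> 0} \<in> K" using that by (auto simp: SK_def)
    have "t * m f \<le> f i" if "i \<in> \<tau>" for i
      using mult_right_mono[OF \<open>t \<le> 1\<close> m_ge[of f]] m_le[OF that, of f] f0 by simp
    then have "0 \<le> h (t, f) i" for i
      using f0 w \<open>0 \<le> t\<close> m_ge[of f] by (auto simp: h_def)
    moreover have "{i. h (t, f) i \<noteq> 0} \<subseteq> insert w {i. f i \<noteq> 0}"
      using True by (auto simp: h_def split: if_splits)
    then have "{i. h (t, f) i \<noteq> 0} \<in> K"
      using down cone[OF fK True] by blast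
    ultimately show ?thesis using that sumh by (simp add: SK_def)
  qed
  have hL: "h (1, f) \<in> SL" if "f \<in> SK" for f
  proof -
    have f0: "\<And>i. 0 \<le> f i" using that by (auto simp: SK_def)
    \<comment> \<open>At time 1 a vertex of \<open>\<tau>\<close> where the minimum is attained has
      lost all its mass, so the support no longer contains \<open>\<tau>\<close>.\<close>
    have "m f \<in> f ` \<tau>" unfolding m_def using fin \<tau> by (intro Min_in) auto
    then obtain i where i: "i \<in> \<tau>" "f i = m f" by auto
    then have "h (1, f) i = 0" using w by (auto simp: h_def)
    then have "\<not> \<tau> \<subseteq> {i. h (1, f) i \<noteq> 0}" using i by auto
    then show ?thesis using hK[OF that, of 1] by (simp add: SK_def SL_def)
  qed
  have hid: "h (t, f) = f" if "f \<in> SL" for t f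
  proof -
    have "\<And>i. 0 \<le> f i" "\<exists>i\<in>\<tau>. f i = 0" using that by (auto simp: SL_def)
    then show ?thesis using m_0 h_m0 by blast
  qed
  have SLK: "SL \<subseteq> SK" by (auto simp: SL_def SK_def)
  let ?X = "subtopology P SK" and ?I = "top_of_set {0..1::real}"
  have projX: "continuous_map ?X euclideanreal (\<lambda>f. f i)" for i
    unfolding P_def by (intro continuous_map_from_subtopology continuous_map_product_projection) simp
  have c_fst: "continuous_map (prod_topology ?I ?X) euclideanreal fst"
    by (intro continuous_map_into_fulltopology[OF continuous_map_fst])
  have c_snd: "continuous_map (prod_topology ?I ?X) euclideanreal (\<lambda>x. snd x i)" for i
    using continuous_map_compose[OF continuous_map_snd projX] by (simp add: o_def)
  have c_m: "continuous_map (prod_topology ?I ?X) euclideanreal (\<lambda>x. m (snd x))"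
    unfolding m_def using fin \<tau> c_snd by (intro continuous_map_Min) auto
  have "continuous_map (prod_topology ?I ?X) P h"
    unfolding P_def continuous_map_componentwise_UNIV h_def case_prod_unfold
    using c_fst c_snd c_m unfolding P_def
    by (intro allI continuous_intros) auto
  then have conth: "continuous_map (prod_topology ?I ?X) ?X h"
    using hK by (auto simp: continuous_map_in_subtopology)
  have "homotopic_with (\<lambda>x. True) ?X ?X id (\<lambda>f. h (1, f))"
    unfolding homotopic_with_def
    using conth by (intro exI[of _ h]) (auto simp: h_def)
  then have hom: "homotopic_with (\<lambda>x. True) ?X ?X (\<lambda>f. h (1, f)) id"
    by (rule homotopic_with_symD)
  then have c1: "continuous_map ?X ?X (\<lambda>f. h (1, f))"
    using homotopic_with_imp_continuous_maps by blast
  have "retraction_maps ?X (subtopology P SL) (\<lambda>f. h (1, f)) id"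
    unfolding retraction_maps_def
    using c1 hL hid SLK
    by (auto simp: continuous_map_in_subtopology intro: continuous_map_from_subtopology)
  with hom have "?X homotopy_equivalent_space subtopology P SL"
    by (rule deformation_retract_imp_homotopy_equivalent_space)
  then show ?thesis by (simp add: RK RL)
qed

text \<open>The faces outside \<open>L\<close> come in pairs \<open>\<sigma> - {w}\<close>,
  \<open>insert w \<sigma>\<close>. A maximal one without \<open>w\<close> lies in no face but
  itself and its partner, so this pair is an elementary collapse; the rest is induction on the
  number of faces outside \<open>L\<close>.\<close>

lemma collapse_matching:
  assumes V: "finite V" "K \<subseteq> Pow V" and w: "w \<in> V"
    and downK: "\<And>\<sigma> \<rho>. \<sigma> \<in> K \<Longrightarrow> \<rho> \<subseteq> \<sigma> \<Longrightarrow> \<rho> \<in> K"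
    and L: "L \<subseteq> K" "L \<noteq> {}"
    and downL: "\<And>\<sigma> \<rho>. \<sigma> \<in> L \<Longrightarrow> \<rho> \<subseteq> \<sigma> \<Longrightarrow> \<rho> \<in> L"
    and ins: "\<And>\<sigma>. \<sigma> \<in> K - L \<Longrightarrow> insert w \<sigma> \<in> K - L"
    and del: "\<And>\<sigma>. \<sigma> \<in> K - L \<Longrightarrow> \<sigma> - {w} \<in> K - L"
  shows "geom_realization K homotopy_equivalent_space geom_realization L"
  using V(2) downK L(1) ins del
proof (induction "card (K - L)" arbitrary: K rule: less_induct)
  case less
  note sub = less.prems(1) and down = less.prems(2) and LK = less.prems(3)
    and ins = less.prems(4) and del = less.prems(5)
  have finK: "finite K" using V(1) sub finite_subset by blast
  show ?case
  proof (cases "K = L")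
    case True
    then show ?thesis by (simp add: homotopy_equivalent_space_refl)
  next
    case False
    define M where "M = {\<sigma>\<in>K - L. w \<notin> \<sigma>}"
    have "finite M" using finK by (simp add: M_def)
    have "M \<noteq> {}" using False LK del by (fastforce simp: M_def)
    from finite_has_maximal[OF \<open>finite M\<close> \<open>M \<noteq> {}\<close>] obtain \<tau>
      where \<tau>: "\<tau> \<in> M" and max: "\<And>\<sigma>. \<sigma> \<in> M \<Longrightarrow> \<tau> \<subseteq> \<sigma> \<Longrightarrow> \<tau> = \<sigma>" by blast
    have \<tau>K: "\<tau> \<in> K" "\<tau> \<notin> L" "w \<notin> \<tau>" using \<tau> by (auto simp: M_def)
    \<comment> \<open>\<open>L\<close> is closed under subsets, so a face above
      \<open>\<tau>\<close> is also outside \<open>L\<close>; removing \<open>w\<close> from it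
      gives a member of \<open>M\<close> above \<open>\<tau>\<close>, and maximality
      applies.\<close>
    have star: "\<sigma> = \<tau> \<or> \<sigma> = insert w \<tau>" if "\<sigma> \<in> K" "\<tau> \<subseteq> \<sigma>" for \<sigma>
    proof -
      have "\<sigma> \<in> K - L" using that \<tau>K downL by blast
      then have "\<sigma> - {w} \<in> M" using del by (auto simp: M_def)
      then have "\<tau> = \<sigma> - {w}" using max that \<tau>K by blast
      then show ?thesis by blast
    qed
    let ?K = "{\<sigma>\<in>K. \<not> \<tau> \<subseteq> \<sigma>}"
    have ins\<tau>: "insert w \<tau> \<in> K" using ins \<tau>K by blast
    have "\<tau> \<noteq> {}" using L(2) downL \<tau>K by blast
    have "geom_realization K homotopy_equivalent_space geom_realization ?K"
    proof (rule collapse_cone_link[OF V(1) sub down])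
      show "insert w \<sigma> \<in> K" if "\<sigma> \<in> K" "\<tau> \<subseteq> \<sigma>" for \<sigma>
        using star[OF that] ins\<tau> by auto
    qed (use \<open>\<tau> \<noteq> {}\<close> \<tau>K sub w in auto)
    also have "geom_realization ?K homotopy_equivalent_space geom_realization L"
    proof (rule less.hyps)
      have "?K - L \<subset> K - L" using \<tau>K by blast
      then show "card (?K - L) < card (K - L)" using finK by (simp add: psubset_card_mono)
      show "L \<subseteq> ?K" using LK downL \<tau>K by blast
      show "insert w \<sigma> \<in> ?K - L" if "\<sigma> \<in> ?K - L" for \<sigma>
        using that ins[of \<sigma>] \<tau>K by auto
      show "\<sigma> - {w} \<in> ?K - L" if "\<sigma> \<in> ?K - L" for \<sigma>
        using that del[of \<sigma>] by auto
    qed (use sub down in blast)+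
    finally show ?thesis .
  qed
qed

text \<open>A point of the boundary of a simplex has minimal coordinate \<open>0\<close>. Hence it is recovered from the
  differences with its last coordinate, up to scaling, by subtracting the minimum.\<close>

lemma boundary_simplex_homeomorphic_nsphere:
  assumes R: "finite R" "card R = p + 2"
  shows "geom_realization {\<sigma>. \<sigma> \<subset> R} homeomorphic_space nsphere p"
proof -
  obtain b where b: "bij_betw b {..Suc p} R"
    using finite_same_card_bij[of "{..Suc p}" R] R by auto
  have inj: "inj_on b {..Suc p}" and im: "b ` {..Suc p} = R"
    using b by (auto simp: bij_betw_def)
  define c where "c = inv_into {..Suc p} b"
  have cb: "c (b i) = i" if "i \<le> Suc p" for i
    using inj that by (simp add: c_def)
  have bc: "b (c r) = r" "c r \<le> Suc p" if "r \<in> R" for r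
    using im that f_inv_into_f[of r b "{..Suc p}"] inv_into_into[of r b "{..Suc p}"]
    by (auto simp: c_def)
  have bR: "b i \<in> R" if "i \<le> Suc p" for i using im that by auto
  define P where "P = (powertop_real UNIV :: (nat \<Rightarrow> real) topology)"
  define SK where "SK = {f. (\<forall>i. 0 \<le> f i) \<and> {i. f i \<noteq> 0} \<in> {\<sigma>. \<sigma> \<subset> R} \<and> (\<Sum>i\<in>R. f i) = (1::real)}"
  define SN where "SN = {x. (\<Sum>i\<le>p. x i ^ 2) = (1::real) \<and> (\<forall>i>p. x i = 0)}"
  have RK: "geom_realization {\<sigma>. \<sigma> \<subset> R} = subtopology P SK"
    unfolding SK_def P_def using R by (intro geom_realization_on) auto
  have RN: "nsphere p = subtopology P SN" by (simp add: nsphere SN_def P_def)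
  define d where "d = (\<lambda>(f::nat \<Rightarrow> real) i. f (b i) - f (b (Suc p)))"
  define N where "N = (\<lambda>f::nat \<Rightarrow> real. sqrt (\<Sum>i\<le>p. (d f i)\<^sup>2))"
  define F where "F = (\<lambda>f i. if i \<le> p then d f i / N f else 0)"
  \<comment> \<open>The index \<open>Suc p\<close> is included: points of \<open>SN\<close> have
    coordinate 0 there, so it stands for the reference vertex \<open>b (Suc p)\<close>.\<close>
  define \<mu> where "\<mu> = (\<lambda>x::nat \<Rightarrow> real. Min (x ` {..Suc p}))"
  define s where "s = (\<lambda>x::nat \<Rightarrow> real. \<Sum>i\<le>Suc p. x i - \<mu> x)"
  define G where "G = (\<lambda>(x::nat \<Rightarrow> real) r. if r \<in> R then (x (c r) - \<mu> x) / s x else 0)"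
  have sumR: "(\<Sum>r\<in>R. g r) = (\<Sum>i\<le>Suc p. g (b i))" for g :: "nat \<Rightarrow> real"
    using sum.reindex_bij_betw[OF b, of g] by simp
  have \<mu>_le: "\<mu> x \<le> x i" if "i \<le> Suc p" for x i using that by (simp add: \<mu>_def)
  have \<mu>_in: "\<exists>i\<le>Suc p. \<mu> x = x i" for x
  proof -
    have "\<mu> x \<in> x ` {..Suc p}" unfolding \<mu>_def by (intro Min_in) auto
    then show ?thesis by auto
  qed
  \<comment> \<open>If all differences vanished, \<open>f\<close> would be constant on
    \<open>R\<close>; but a boundary point vanishes somewhere on \<open>R\<close>, so its sum would
    be 0 instead of 1.\<close>
  have Npos: "0 < N f" if "f \<in> SK" for f
  proof (rule ccontr)
    assume "\<not> 0 < N f"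
    then have "(\<Sum>i\<le>p. (d f i)\<^sup>2) \<le> 0" by (simp add: N_def)
    then have "(\<Sum>i\<le>p. (d f i)\<^sup>2) = 0" by (simp add: antisym sum_nonneg)
    then have "\<And>i. i \<le> p \<Longrightarrow> d f i = 0" by (simp add: sum_nonneg_eq_0_iff)
    then have eq: "\<And>i. i \<le> Suc p \<Longrightarrow> f (b i) = f (b (Suc p))"
      by (auto simp: d_def le_Suc_eq)
    have "{i. f i \<noteq> 0} \<subset> R" using that by (auto simp: SK_def)
    then obtain r where "r \<in> R" "f r = 0" by blast
    then have "f (b (Suc p)) = 0" using eq[of "c r"] bc[of r] by auto
    then have "\<And>i. i \<le> Suc p \<Longrightarrow> f (b i) = 0" using eq by metis
    then have "(\<Sum>r\<in>R. f r) = 0" by (simp add: sumR)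
    then show False using that by (simp add: SK_def)
  qed
  have spos: "0 < s x" if "x \<in> SN" for x
  proof -
    have 0: "x (Suc p) = 0" using that by (simp add: SN_def)
    have "\<exists>i\<le>Suc p. x i - \<mu> x \<noteq> 0"
    proof (rule ccontr)
      assume "\<not> ?thesis"
      then have "\<And>i. i \<le> Suc p \<Longrightarrow> x i = x (Suc p)" by (metis eq_iff_diff_eq_0 le_refl)
      then have "(\<Sum>i\<le>p. x i ^ 2) = 0" using 0 by simp
      then show False using that by (simp add: SN_def)
    qed
    then have "s x \<noteq> 0" unfolding s_def
      using \<mu>_le by (subst sum_nonneg_eq_0_iff) auto
    moreover have "s x \<ge> 0" unfolding s_def using \<mu>_le by (intro sum_nonneg) auto
    ultimately show ?thesis by simp
  qed
  have FN: "F f \<in> SN" if "f \<in> SK" for f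
  proof -
    have "(\<Sum>i\<le>p. F f i ^ 2) = (\<Sum>i\<le>p. (d f i)\<^sup>2) / (N f)\<^sup>2"
      by (simp add: F_def power_divide sum_divide_distrib)
    also have "(N f)\<^sup>2 = (\<Sum>i\<le>p. (d f i)\<^sup>2)" by (simp add: N_def sum_nonneg)
    finally show ?thesis using Npos[OF that] by (auto simp: SN_def F_def N_def)
  qed
  have GK: "G x \<in> SK" if "x \<in> SN" for x
  proof -
    have "0 \<le> G x i" for i
      using spos[OF that] \<mu>_le[OF bc(2)] by (auto simp: G_def)
    moreover obtain i where i: "i \<le> Suc p" "\<mu> x = x i" using \<mu>_in by blast
    then have "G x (b i) = 0" by (simp add: G_def cb)
    then have "{i. G x i \<noteq> 0} \<subset> R" using bR[OF i(1)] by (auto simp: G_def split: if_splits)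
    moreover have "(\<Sum>r\<in>R. G x r) = (\<Sum>i\<le>Suc p. (x i - \<mu> x) / s x)"
      unfolding sumR by (intro sum.cong) (auto simp: G_def bR cb)
    then have "(\<Sum>r\<in>R. G x r) = 1"
      using spos[OF that] by (simp add: s_def flip: sum_divide_distrib)
    ultimately show ?thesis by (simp add: SK_def)
  qed
  have GF: "G (F f) = f" if f: "f \<in> SK" for f
  proof -
    have N: "0 < N f" using Npos f .
    have f0: "\<And>i. 0 \<le> f i" and sub: "{i. f i \<noteq> 0} \<subset> R" and f1: "(\<Sum>i\<in>R. f i) = 1"
      using f by (auto simp: SK_def)
    have Ff: "F f i = (f (b i) - f (b (Suc p))) / N f" if "i \<le> Suc p" for i
      using that by (auto simp: F_def d_def le_Suc_eq)
    \<comment> \<open>The minimum is attained at a vertex where \<open>f\<close> vanishes, so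
      subtracting it undoes the shift by \<open>f (b (Suc p))\<close>.\<close>
    have \<mu>: "\<mu> (F f) = - f (b (Suc p)) / N f"
      unfolding \<mu>_def
    proof (rule Min_eqI)
      show "- f (b (Suc p)) / N f \<le> y" if "y \<in> F f ` {..Suc p}" for y
        using that Ff N f0 by (auto simp: diff_divide_distrib)
      obtain r where "r \<in> R" "f r = 0" using sub by blast
      then have "F f (c r) = - f (b (Suc p)) / N f" using Ff[of "c r"] bc[of r] by simp
      then show "- f (b (Suc p)) / N f \<in> F f ` {..Suc p}" using bc(2)[OF \<open>r \<in> R\<close>] by force
    qed simp
    have val: "F f i - \<mu> (F f) = f (b i) / N f" if "i \<le> Suc p" for i
      using Ff[OF that] by (simp add: \<mu> diff_divide_distrib)
    then have "s (F f) = (\<Sum>i\<le>Suc p. f (b i) / N f)" unfolding s_def by (intro sum.cong) auto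
    also have "\<dots> = 1 / N f" using f1 by (simp add: sumR flip: sum_divide_distrib)
    finally have s: "s (F f) = 1 / N f" .
    show ?thesis
    proof
      show "G (F f) r = f r" for r
        using sub val[of "c r"] bc[of r] N by (auto simp: G_def s)
    qed
  qed
  have FG: "F (G x) = x" if x: "x \<in> SN" for x
  proof -
    have x0: "\<And>i. i > p \<Longrightarrow> x i = 0" and x1: "(\<Sum>i\<le>p. (x i)\<^sup>2) = 1" using x by (auto simp: SN_def)
    have s: "0 < s x" using spos x .
    have Gb: "G x (b i) = (x i - \<mu> x) / s x" if "i \<le> Suc p" for i
      using that by (simp add: G_def bR cb)
    have dG: "d (G x) i = x i / s x" if "i \<le> p" for i
      using that x0[of "Suc p"] by (simp add: d_def Gb diff_divide_distrib)
    have "N (G x) = sqrt ((\<Sum>i\<le>p. (x i)\<^sup>2) / (s x)\<^sup>2)"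
      unfolding N_def by (simp add: dG power_divide sum_divide_distrib)
    then have "N (G x) = 1 / s x" using s x1 by (simp add: real_sqrt_divide)
    then show ?thesis using s x0 dG by (auto simp: F_def fun_eq_iff not_le)
  qed
  have projK: "continuous_map (subtopology P SK) euclideanreal (\<lambda>f. f i)" for i
    unfolding P_def by (intro continuous_map_from_subtopology continuous_map_product_projection) simp
  have projN: "continuous_map (subtopology P SN) euclideanreal (\<lambda>f. f i)" for i
    unfolding P_def by (intro continuous_map_from_subtopology continuous_map_product_projection) simp
  have cN: "continuous_map (subtopology P SK) euclideanreal N"
    unfolding N_def d_def by (intro continuous_intros projK) auto
  have "continuous_map (subtopology P SK) euclideanreal (\<lambda>f. F f k)" for k
  proof (cases "k \<le> p")
    case True
    have "N f \<noteq> 0" if "f \<in> topspace (subtopology P SK)" for f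
      using that Npos[of f] by (simp add: topspace_subtopology)
    then have "continuous_map (subtopology P SK) euclideanreal (\<lambda>f. d f k / N f)"
      unfolding d_def by (intro continuous_intros projK cN) auto
    then show ?thesis using True by (simp add: F_def)
  qed (simp add: F_def)
  then have cF: "continuous_map (subtopology P SK) (subtopology P SN) F"
    using FN by (auto simp: continuous_map_in_subtopology P_def continuous_map_componentwise_UNIV)
  have c\<mu>: "continuous_map (subtopology P SN) euclideanreal \<mu>"
    unfolding \<mu>_def by (intro continuous_map_Min projN) auto
  have cs: "continuous_map (subtopology P SN) euclideanreal s"
    unfolding s_def by (intro continuous_intros projN c\<mu>) auto
  have "continuous_map (subtopology P SN) euclideanreal (\<lambda>x. G x k)" for k
  proof (cases "k \<in> R")
    case True
    have "s x \<noteq> 0" if "x \<in> topspace (subtopology P SN)" for x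
      using that spos[of x] by (simp add: topspace_subtopology)
    then have "continuous_map (subtopology P SN) euclideanreal (\<lambda>x. (x (c k) - \<mu> x) / s x)"
      by (intro continuous_intros projN c\<mu> cs) auto
    then show ?thesis using True by (simp add: G_def)
  qed (simp add: G_def)
  then have cG: "continuous_map (subtopology P SN) (subtopology P SK) G"
    using GK by (auto simp: continuous_map_in_subtopology P_def continuous_map_componentwise_UNIV)
  have "homeomorphic_maps (subtopology P SK) (subtopology P SN) F G"
    unfolding homeomorphic_maps_def using cF cG GF FG by auto
  then show ?thesis unfolding RK RN homeomorphic_space_def by blast
qed

subsection \<open>Complexes cut out by hyperedges\<close>

text \<open>For \<open>H\<close> consisting of subsets of \<open>V\<close> this is the Alexander
  dual of the complex of those subsets of \<open>V\<close> that contain no member of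
  \<open>H\<close>.\<close>

definition cut_cx :: "nat set \<Rightarrow> nat set set \<Rightarrow> nat set set" where
  "cut_cx V H = {\<sigma>. \<sigma> \<subseteq> V \<and> (\<exists>h\<in>H. h \<inter> \<sigma> = {})}"

lemma cut_cx_down: "\<sigma> \<in> cut_cx V H \<Longrightarrow> \<rho> \<subseteq> \<sigma> \<Longrightarrow> \<rho> \<in> cut_cx V H"
  unfolding cut_cx_def by blast

text \<open>A set disjoint from \<open>h\<close> is disjoint from every subset of \<open>h\<close>,
  so hyperedges that contain another one can be added or dropped freely.\<close>

lemma cut_cx_cong:
  assumes "\<And>h. h \<in> H \<Longrightarrow> \<exists>h'\<in>H'. h' \<subseteq> h" "\<And>h. h \<in> H' \<Longrightarrow> \<exists>h'\<in>H. h' \<subseteq> h"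
  shows "cut_cx V H = cut_cx V H'"
proof -
  have sub: "cut_cx V H\<^sub>1 \<subseteq> cut_cx V H\<^sub>2" if ref: "\<And>h. h \<in> H\<^sub>1 \<Longrightarrow> \<exists>h'\<in>H\<^sub>2. h' \<subseteq> h" for H\<^sub>1 H\<^sub>2
  proof
    fix \<sigma> assume "\<sigma> \<in> cut_cx V H\<^sub>1"
    then obtain h where "\<sigma> \<subseteq> V" "h \<in> H\<^sub>1" "h \<inter> \<sigma> = {}" by (auto simp: cut_cx_def)
    moreover obtain h' where "h' \<in> H\<^sub>2" "h' \<subseteq> h" using ref \<open>h \<in> H\<^sub>1\<close> by blast
    ultimately show "\<sigma> \<in> cut_cx V H\<^sub>2" unfolding cut_cx_def by blast
  qed
  show ?thesis using sub[of H H'] sub[of H' H] assms by blast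
qed

text \<open>The hypothesis on \<open>w\<close> says that adding or removing \<open>w\<close> matches perfectly the faces whose
  complement contains \<open>h\<close> but no member of \<open>H\<close>.\<close>

lemma cut_cx_insert:
  assumes V: "finite V" and w: "w \<in> V" "w \<notin> h" and H: "H \<noteq> {}"
    and dom: "\<And>e. e \<in> H \<Longrightarrow> w \<in> e \<Longrightarrow> \<exists>f\<in>H. f \<subseteq> h \<union> (e - {w})"
  shows "geom_realization (cut_cx V (insert h H)) homotopy_equivalent_space
         geom_realization (cut_cx V H)"
proof (rule collapse_matching[OF V _ w(1)])
  show "insert w \<sigma> \<in> cut_cx V (insert h H) - cut_cx V H"
    if "\<sigma> \<in> cut_cx V (insert h H) - cut_cx V H" for \<sigma>
    using that w by (fastforce simp: cut_cx_def)
  show "\<sigma> - {w} \<in> cut_cx V (insert h H) - cut_cx V H"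
    if "\<sigma> \<in> cut_cx V (insert h H) - cut_cx V H" for \<sigma>
  proof -
    have \<sigma>: "\<sigma> \<subseteq> V" "h \<inter> \<sigma> = {}" and ne: "\<And>e. e \<in> H \<Longrightarrow> e \<inter> \<sigma> \<noteq> {}"
      using that by (auto simp: cut_cx_def)
    \<comment> \<open>If \<open>\<sigma>\<close> met \<open>e\<close> only in \<open>w\<close>, the
      replacement \<open>f\<close> would avoid \<open>\<sigma>\<close> altogether.\<close>
    have "e \<inter> (\<sigma> - {w}) \<noteq> {}" if e: "e \<in> H" for e
    proof
      assume 0: "e \<inter> (\<sigma> - {w}) = {}"
      then have "w \<in> e" using ne[OF e] by blast
      from dom[OF e this] obtain f where "f \<in> H" "f \<subseteq> h \<union> (e - {w})" by blast
      then show False using ne[of f] 0 \<sigma> by blast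
    qed
    then show ?thesis using \<sigma> by (auto simp: cut_cx_def)
  qed
  show "cut_cx V H \<noteq> {}" using H by (auto simp: cut_cx_def)
  show "cut_cx V (insert h H) \<subseteq> Pow V" "cut_cx V H \<subseteq> cut_cx V (insert h H)"
    by (auto simp: cut_cx_def)
qed (rule cut_cx_down; assumption)+

text \<open>Members of \<open>F\<close> avoid \<open>w\<close>, so the hyperedges through
  \<open>w\<close> remain those of \<open>H\<close> while \<open>F\<close> is being added;
  \<open>cut_cx_insert\<close> applies to each member in turn with the same apex.\<close>

lemma cut_cx_union:
  assumes V: "finite V" and w: "w \<in> V" and F: "finite F" "\<And>h. h \<in> F \<Longrightarrow> w \<notin> h" and H: "H \<noteq> {}"
    and dom: "\<And>h e. h \<in> F \<Longrightarrow> e \<in> H \<Longrightarrow> w \<in> e \<Longrightarrow> \<exists>f\<in>H. f \<subseteq> h \<union> (e - {w})"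
  shows "geom_realization (cut_cx V (F \<union> H)) homotopy_equivalent_space
         geom_realization (cut_cx V H)"
  using F dom
proof (induction F rule: finite_induct)
  case empty
  then show ?case by (simp add: homotopy_equivalent_space_refl)
next
  case (insert h F)
  have "geom_realization (cut_cx V (insert h (F \<union> H))) homotopy_equivalent_space
        geom_realization (cut_cx V (F \<union> H))"
  proof (rule cut_cx_insert[OF V w])
    show "\<exists>f\<in>F \<union> H. f \<subseteq> h \<union> (e - {w})" if "e \<in> F \<union> H" "w \<in> e" for e
      using that insert.prems(1)[of e] insert.prems(2)[of h e] by blast
  qed (use insert.prems H in auto)
  also have "geom_realization (cut_cx V (F \<union> H)) homotopy_equivalent_space
             geom_realization (cut_cx V H)"
    using insert.prems by (intro insert.IH) auto
  finally show ?case by simp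
qed

text \<open>The larger \<open>h \<union> g\<close> is added first with apex \<open>w'\<close>, then
  serves as a replacement when \<open>h\<close> is added with apex \<open>w\<close>, and is finally
  absorbed by its subset \<open>h\<close>.\<close>

lemma cut_cx_insert2:
  assumes V: "finite V" and w: "w \<in> V" "w \<notin> h \<union> g" and w': "w' \<in> V" "w' \<notin> h \<union> g" and H: "H \<noteq> {}"
    and dom': "\<And>e. e \<in> H \<Longrightarrow> w' \<in> e \<Longrightarrow> \<exists>f\<in>H. f \<subseteq> h \<union> g \<union> (e - {w'})"
    and dom: "\<And>e. e \<in> H \<Longrightarrow> w \<in> e \<Longrightarrow> \<exists>f\<in>insert (h \<union> g) H. f \<subseteq> h \<union> (e - {w})"
  shows "geom_realization (cut_cx V H) homotopy_equivalent_space
         geom_realization (cut_cx V (insert h H))"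
proof -
  have "geom_realization (cut_cx V H) homotopy_equivalent_space
        geom_realization (cut_cx V (insert (h \<union> g) H))"
    by (subst homotopy_equivalent_space_sym, rule cut_cx_insert[OF V w' H dom'])
  also have "geom_realization (cut_cx V (insert (h \<union> g) H)) homotopy_equivalent_space
             geom_realization (cut_cx V (insert h (insert (h \<union> g) H)))"
    by (subst homotopy_equivalent_space_sym, rule cut_cx_insert[OF V w(1)]) (use w dom in auto)
  also have "cut_cx V (insert h (insert (h \<union> g) H)) = cut_cx V (insert h H)"
    by (rule cut_cx_cong) auto
  finally show ?thesis .
qed

text \<open>A vertex \<open>a\<close> outside a system of representatives can be deleted: a face
  containing \<open>a\<close> avoids some block other than that of \<open>a\<close>, so the
  representative of the block of \<open>a\<close> can be added, and the link of \<open>a\<close> is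
  a cone. What survives are the proper subsets of the set of representatives.\<close>

lemma cut_cx_partition_homotopy_nsphere:
  assumes V: "finite V" "\<Union>H = V" and disj: "disjoint H" "{} \<notin> H" and card: "card H = p + 2"
  shows "geom_realization (cut_cx V H) homotopy_equivalent_space nsphere p"
proof -
  define rep where "rep h = (SOME x. x \<in> h)" for h :: "nat set"
  define R where "R = rep ` H"
  have rep: "rep h \<in> h" if "h \<in> H" for h
    using that disj(2) some_in_eq[of h] by (auto simp: rep_def)
  have same: "h = h'" if "h \<in> H" "h' \<in> H" "x \<in> h" "x \<in> h'" for h h' x
    using that disj(1) by (auto simp: disjoint_def)
  have "inj_on rep H" using rep same by (metis inj_onI)
  then have cardR: "card R = p + 2" using card by (simp add: R_def card_image)
  have RV: "R \<subseteq> V" using rep V by (auto simp: R_def)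
  have "geom_realization (cut_cx V H) homotopy_equivalent_space
        geom_realization {\<sigma>\<in>cut_cx V H. \<sigma> \<inter> A = {}}" if "finite A" "A \<subseteq> V - R" for A
    using that
  proof (induction A rule: finite_induct)
    case empty
    then show ?case by (simp add: homotopy_equivalent_space_refl)
  next
    case (insert a A)
    let ?K = "{\<sigma>\<in>cut_cx V H. \<sigma> \<inter> A = {}}"
    obtain h where h: "h \<in> H" "a \<in> h" using insert.prems V by blast
    have wR: "rep h \<in> R" using h by (simp add: R_def)
    have "geom_realization ?K homotopy_equivalent_space geom_realization {\<sigma>\<in>?K. \<not> {a} \<subseteq> \<sigma>}"
    proof (rule collapse_cone_link[OF V(1)])
      show "insert (rep h) \<sigma> \<in> ?K" if \<sigma>: "\<sigma> \<in> ?K" "{a} \<subseteq> \<sigma>" for \<sigma>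
      proof -
        obtain h' where h': "h' \<in> H" "h' \<inter> \<sigma> = {}" using \<sigma> by (auto simp: cut_cx_def)
        then have "rep h \<notin> h'" using same[OF h(1) h'(1) rep[OF h(1)]] h \<sigma> by blast
        then show ?thesis
          using \<sigma> h' wR RV insert.prems by (auto simp: cut_cx_def)
      qed
      show "rep h \<in> V" "rep h \<notin> {a}" "{a} \<subseteq> V" using wR RV insert.prems by auto
      show "?K \<subseteq> Pow V" by (auto simp: cut_cx_def)
      show "\<rho> \<in> ?K" if "\<sigma> \<in> ?K" "\<rho> \<subseteq> \<sigma>" for \<sigma> \<rho>
        using that cut_cx_down[of \<sigma> V H \<rho>] by blast
    qed simp
    moreover have "{\<sigma>\<in>?K. \<not> {a} \<subseteq> \<sigma>} = {\<sigma>\<in>cut_cx V H. \<sigma> \<inter> insert a A = {}}" by auto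
    ultimately show ?case using insert homotopy_eqv_trans by auto
  qed
  from this[of "V - R"] V(1) have "geom_realization (cut_cx V H) homotopy_equivalent_space
        geom_realization {\<sigma>\<in>cut_cx V H. \<sigma> \<inter> (V - R) = {}}" by auto
  also have "{\<sigma>\<in>cut_cx V H. \<sigma> \<inter> (V - R) = {}} = {\<sigma>. \<sigma> \<subset> R}"
  proof (intro equalityI subsetI)
    fix \<sigma> assume "\<sigma> \<in> {\<sigma>\<in>cut_cx V H. \<sigma> \<inter> (V - R) = {}}"
    then obtain h where "\<sigma> \<subseteq> R" "h \<in> H" "h \<inter> \<sigma> = {}" by (auto simp: cut_cx_def)
    then show "\<sigma> \<in> {\<sigma>. \<sigma> \<subset> R}" using rep[of h] by (auto simp: R_def)
  next
    fix \<sigma> assume "\<sigma> \<in> {\<sigma>. \<sigma> \<subset> R}"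
    then obtain h where h: "h \<in> H" "rep h \<notin> \<sigma>" and "\<sigma> \<subseteq> R" by (auto simp: R_def)
    then have "h \<inter> \<sigma> = {}" using same[OF h(1) _ _ rep] by (fastforce simp: R_def)
    then show "\<sigma> \<in> {\<sigma>\<in>cut_cx V H. \<sigma> \<inter> (V - R) = {}}"
      using h \<open>\<sigma> \<subseteq> R\<close> RV by (auto simp: cut_cx_def)
  qed
  also have "geom_realization {\<sigma>. \<sigma> \<subset> R} homotopy_equivalent_space nsphere p"
    using V(1) RV finite_subset cardR
    by (intro homeomorphic_imp_homotopy_equivalent_space boundary_simplex_homeomorphic_nsphere) auto
  finally show ?thesis .
qed

section \<open>Independent triples and the effect of a new edge\<close>

text \<open>The set \<open>U\<close> is kept apart from the vertex set of the complex: when the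
  cycle is shortened, \<open>U\<close> shrinks while the complex keeps all its vertices.\<close>

definition indep3 :: "nat set \<Rightarrow> (nat \<Rightarrow> nat \<Rightarrow> bool) \<Rightarrow> nat set set" where
  "indep3 U A = {S. S \<subseteq> U \<and> card S = 3 \<and> (\<forall>x\<in>S. \<forall>y\<in>S. \<not> A x y)}"

lemma indep3_E:
  assumes "S \<in> indep3 U A" "w \<in> S"
  obtains x y where "S = {w, x, y}" "w \<noteq> x" "w \<noteq> y" "x \<noteq> y" "w \<in> U" "x \<in> U" "y \<in> U"
    "\<not> A w x" "\<not> A w y" "\<not> A x y" "\<not> A x w" "\<not> A y w" "\<not> A y x"
proof -
  have "card (S - {w}) = 2" using assms by (simp add: indep3_def)
  then obtain x y where "S - {w} = {x, y}" "x \<noteq> y" by (auto simp: card_2_iff)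
  moreover from this have "S = {w, x, y}" "w \<noteq> x" "w \<noteq> y" using assms(2) by auto
  ultimately show thesis using assms that by (auto simp: indep3_def)
qed

definition with_edge :: "nat \<Rightarrow> nat \<Rightarrow> (nat \<Rightarrow> nat \<Rightarrow> bool) \<Rightarrow> nat \<Rightarrow> nat \<Rightarrow> bool" where
  "with_edge a b A x y \<longleftrightarrow> A x y \<or> (x = a \<and> y = b) \<or> (x = b \<and> y = a)"

text \<open>The triples containing \<open>a\<close> and \<open>b\<close> are added one at a time, always with the common neighbour \<open>w\<close>
  as apex of the matching.\<close>

lemma cut_cx_add_edge:
  assumes V: "finite V" and U: "U \<subseteq> V"
    and sym: "\<And>x y. A x y \<Longrightarrow> A y x" and irr: "\<And>x. \<not> A x x"
    and abw: "a \<in> U" "b \<in> U" "w \<in> U" "A w a" "A w b" "a \<noteq> b"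
    and X: "\<And>h. h \<in> X \<Longrightarrow> w \<notin> h" and ne: "indep3 U (with_edge a b A) \<union> X \<noteq> {}"
    and common: "\<And>z. z \<in> U \<Longrightarrow> A a z \<Longrightarrow> A b z \<Longrightarrow> z \<noteq> w \<Longrightarrow> A w z"
    and path: "\<And>x y c. \<lbrakk>x \<in> U; y \<in> U; c \<in> U; A b x; A a y; \<not> A w x; \<not> A w y; x \<noteq> w; y \<noteq> w; A x c; A y c\<rbrakk>
        \<Longrightarrow> A a c \<or> A b c"
  shows "geom_realization (cut_cx V (indep3 U A \<union> X)) homotopy_equivalent_space
         geom_realization (cut_cx V (indep3 U (with_edge a b A) \<union> X))"
proof -
  define F where "F = {h \<in> indep3 U A. a \<in> h \<and> b \<in> h}"
  \<comment> \<open>The triples destroyed by the edge from \<open>a\<close> to \<open>b\<close> are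
    exactly those of \<open>F\<close>.\<close>
  have eq: "indep3 U A \<union> X = F \<union> (indep3 U (with_edge a b A) \<union> X)"
    using abw by (auto simp: F_def indep3_def with_edge_def)
  have in0: "{p, q, r} \<in> indep3 U (with_edge a b A)"
    if "p \<in> U" "q \<in> U" "r \<in> U" "p \<noteq> q" "p \<noteq> r" "q \<noteq> r" "\<not> A p q" "\<not> A p r" "\<not> A q r"
      "\<not> (a \<in> {p, q, r} \<and> b \<in> {p, q, r})" for p q r
    using that sym irr by (auto simp: indep3_def with_edge_def)
  show ?thesis unfolding eq
  proof (rule cut_cx_union[OF V])
    have "indep3 U A \<subseteq> Pow V" using U by (auto simp: indep3_def)
    then show "finite F" using V by (auto simp: F_def intro: finite_subset)
    show "w \<in> V" using abw U by blast
    show "w \<notin> h" if "h \<in> F" for h using that abw by (auto simp: F_def indep3_def)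
    show "\<exists>f\<in>indep3 U (with_edge a b A) \<union> X. f \<subseteq> h \<union> (e - {w})"
      if h: "h \<in> F" and e: "e \<in> indep3 U (with_edge a b A) \<union> X" "w \<in> e" for h e
    proof (rule ccontr)
      assume no: "\<not> ?thesis"
      have e0: "e \<in> indep3 U (with_edge a b A)" using e X by blast
      from e0 e(2) obtain x y where e'': "e = {w, x, y}" "w \<noteq> x" "w \<noteq> y" "x \<noteq> y" "x \<in> U" "y \<in> U"
        "\<not> with_edge a b A w x" "\<not> with_edge a b A w y" "\<not> with_edge a b A x y"
        by (rule indep3_E)
      then have e': "e = {w, x, y}" "w \<noteq> x" "w \<noteq> y" "x \<noteq> y" "x \<in> U" "y \<in> U"
        "\<not> A w x" "\<not> A w y" "\<not> A x y"
        by (simp_all add: with_edge_def)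
      from h have "h \<in> indep3 U A" "a \<in> h" "b \<in> h" by (auto simp: F_def)
      obtain c where h': "h = {a, b, c}" "a \<noteq> c" "b \<noteq> c" "c \<in> U" "\<not> A a c" "\<not> A b c" "\<not> A a b"
      proof -
        obtain p q where pq: "h = {a, p, q}" "a \<noteq> p" "a \<noteq> q" "p \<noteq> q" "p \<in> U" "q \<in> U"
          "\<not> A a p" "\<not> A a q" "\<not> A p q" "\<not> A q p"
          using indep3_E[OF \<open>h \<in> indep3 U A\<close> \<open>a \<in> h\<close>] by metis
        have "b = p \<or> b = q" using \<open>b \<in> h\<close> pq(1) abw(6) by auto
        then show thesis using that[of q] that[of p] pq by (auto simp: insert_commute)
      qed
      have xy: "x \<noteq> a" "x \<noteq> b" "y \<noteq> a" "y \<noteq> b" using e' abw by auto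
      have no': "{p, q, r} \<notin> indep3 U (with_edge a b A)" if "{p, q, r} \<subseteq> {a, b, c, x, y} - {w}" for p q r
      proof -
        have "{p, q, r} \<subseteq> h \<union> (e - {w})" using that unfolding e'(1) h'(1) by blast
        then show ?thesis using no by (meson UnI1)
      qed
      have nw: "a \<noteq> w" "b \<noteq> w" using abw irr by auto
      have "c \<noteq> w" using abw h' sym by auto
      note nw = nw this
      \<comment> \<open>\<open>{a, x, y}\<close> and \<open>{b, x, y}\<close> are not independent
        while \<open>x\<close> and \<open>y\<close> are nonadjacent, so each of \<open>a\<close> and
        \<open>b\<close> has a neighbour among \<open>x\<close>, \<open>y\<close>.\<close>
      have 1: "A a x \<or> A a y"
        using no'[of a x y] in0[of a x y] abw e' xy nw by auto
      have 2: "A b x \<or> A b y"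
        using no'[of b x y] in0[of b x y] abw e' xy nw by auto
      \<comment> \<open>By \<open>common\<close>, \<open>u\<close> is not adjacent to
        \<open>a\<close>, nor \<open>v\<close> to \<open>b\<close>. As \<open>{a, u, c}\<close> and
        \<open>{b, v, c}\<close> are not independent, \<open>c\<close> is adjacent to
        \<open>u\<close> and \<open>v\<close>, and \<open>path\<close> contradicts the independence
        of \<open>h\<close>.\<close>
      have contra: False
        if Au: "A b u" and Av: "A a v" and uv0: "u \<in> {x, y}" "v \<in> {x, y}" for u v
      proof -
        have uv: "u \<in> U" "v \<in> U" "u \<noteq> w" "v \<noteq> w" "\<not> A w u" "\<not> A w v" "u \<noteq> a" "u \<noteq> b" "v \<noteq> a" "v \<noteq> b"
          using uv0 e' xy by auto
        have n: "\<not> A a u" "\<not> A b v" using common[of u] common[of v] uv Au Av by auto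
        have cn: "c \<noteq> u" "c \<noteq> v" using h' Au Av by auto
        have "{a, u, c} \<subseteq> {a, b, c, x, y} - {w}" "{b, v, c} \<subseteq> {a, b, c, x, y} - {w}"
          using uv0 uv nw by auto
        then have "{a, u, c} \<notin> indep3 U (with_edge a b A)" "{b, v, c} \<notin> indep3 U (with_edge a b A)"
          using no' by metis+
        then have "A u c" "A v c"
          using in0[of a u c] in0[of b v c] abw uv n h' cn by auto
        then show False using path[of u v c] uv Au Av h' by auto
      qed
      have "\<not> (A a x \<and> A b x)" "\<not> (A a y \<and> A b y)" using common[of x] common[of y] e' by auto
      then show False using 1 2 contra[of x y] contra[of y x] by auto
    qed
  qed (use ne in auto)
qed

subsection \<open>Squared cycles and cycles\<close>

definition cyc :: "nat \<Rightarrow> nat \<Rightarrow> nat \<Rightarrow> bool" where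
  "cyc m x y \<longleftrightarrow> x = Suc y \<or> y = Suc x \<or> (x = 1 \<and> y = m) \<or> (x = m \<and> y = 1)"

definition cpred :: "nat \<Rightarrow> nat \<Rightarrow> nat" where
  "cpred n i = (if i = 1 then n else i - 1)"

lemma csucc_eq: "i \<in> {1..n} \<Longrightarrow> csucc n i = (if i = n then 1 else Suc i)"
  by (auto simp: csucc_def)

text \<open>The cycle together with the chords whose midpoint lies in \<open>J\<close>: it interpolates between \<open>C\<^sub>n\<close> and \<open>W\<^sub>n\<close>.\<close>

definition adj :: "nat \<Rightarrow> nat set \<Rightarrow> nat \<Rightarrow> nat \<Rightarrow> bool" where
  "adj n J x y \<longleftrightarrow> cyc n x y \<or> (\<exists>j\<in>J. {x, y} = {cpred n j, csucc n j})"

lemma adj_insert: "adj n (insert w J) = with_edge (cpred n w) (csucc n w) (adj n J)"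
  by (auto simp: fun_eq_iff adj_def with_edge_def doubleton_eq_iff)

text \<open>The edges \<open>{i, i + 2}\<close> are reindexed by their midpoint
  \<open>csucc n i\<close>; \<open>cpred n\<close> inverts \<open>csucc n\<close> on
  \<open>{1..n}\<close>.\<close>

lemma adj_iff_edge:
  assumes "n \<ge> 3" "x \<in> {1..n}" "y \<in> {1..n}"
  shows "adj n {1..n} x y \<longleftrightarrow> {x, y} \<in> sq_cycle_edges n"
proof -
  have "cyc n x y \<longleftrightarrow> (\<exists>i\<in>{1..n}. {x, y} = {i, csucc n i})"
  proof
    assume "cyc n x y"
    then have "y = csucc n x \<or> x = csucc n y" using assms by (auto simp: cyc_def csucc_eq)
    then show "\<exists>i\<in>{1..n}. {x, y} = {i, csucc n i}" using assms by (metis insert_commute)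
  next
    assume "\<exists>i\<in>{1..n}. {x, y} = {i, csucc n i}"
    then show "cyc n x y" by (auto simp: cyc_def csucc_eq doubleton_eq_iff split: if_splits)
  qed
  moreover have "(\<exists>j\<in>{1..n}. {x, y} = {cpred n j, csucc n j}) \<longleftrightarrow>
    (\<exists>i\<in>{1..n}. {x, y} = {i, csucc n (csucc n i)})"
  proof
    assume "\<exists>j\<in>{1..n}. {x, y} = {cpred n j, csucc n j}"
    then obtain j where j: "j \<in> {1..n}" "{x, y} = {cpred n j, csucc n j}" by blast
    then have "cpred n j \<in> {1..n}" "csucc n (cpred n j) = j"
      using assms(1) by (auto simp: cpred_def csucc_def)
    then show "\<exists>i\<in>{1..n}. {x, y} = {i, csucc n (csucc n i)}" using j by metis
  next
    assume "\<exists>i\<in>{1..n}. {x, y} = {i, csucc n (csucc n i)}"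
    then obtain i where i: "i \<in> {1..n}" "{x, y} = {i, csucc n (csucc n i)}" by blast
    then have "csucc n i \<in> {1..n}" "cpred n (csucc n i) = i"
      using assms(1) by (auto simp: cpred_def csucc_eq)
    then show "\<exists>j\<in>{1..n}. {x, y} = {cpred n j, csucc n j}" using i by metis
  qed
  moreover have "{x, y} \<in> sq_cycle_edges n \<longleftrightarrow> (\<exists>i\<in>{1..n}. {x, y} = {i, csucc n i}) \<or>
      (\<exists>i\<in>{1..n}. {x, y} = {i, csucc n (csucc n i)})"
    unfolding sq_cycle_edges_def Un_iff mem_Collect_eq by (simp only: Bex_def conj_commute)
  ultimately show ?thesis unfolding adj_def by simp
qed

lemma total_cut_complex_sq_cycle:
  assumes "n \<ge> 3"
  shows "total_cut_complex 3 {1..n} (sq_cycle_edges n) = cut_cx {1..n} (indep3 {1..n} (adj n {1..n}))"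
proof -
  have "independent_set {1..n} (sq_cycle_edges n) S \<longleftrightarrow>
      S \<subseteq> {1..n} \<and> (\<forall>x\<in>S. \<forall>y\<in>S. \<not> adj n {1..n} x y)" for S
  proof -
    have "\<exists>x y. e = {x, y}" if "e \<in> sq_cycle_edges n" for e
      using that by (auto simp: sq_cycle_edges_def)
    then have "(\<forall>e\<in>sq_cycle_edges n. \<not> e \<subseteq> S) \<longleftrightarrow> (\<forall>x\<in>S. \<forall>y\<in>S. {x, y} \<notin> sq_cycle_edges n)"
      by (metis empty_subsetI insert_subset)
    moreover have "(\<forall>x\<in>S. \<forall>y\<in>S. {x, y} \<notin> sq_cycle_edges n) \<longleftrightarrow> (\<forall>x\<in>S. \<forall>y\<in>S. \<not> adj n {1..n} x y)"
      if "S \<subseteq> {1..n}"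
      using adj_iff_edge[OF assms] that by (meson subsetD)
    ultimately show ?thesis unfolding independent_set_def by metis
  qed
  then have "S \<subseteq> {1..n} - \<sigma> \<and> card S = 3 \<and> independent_set {1..n} (sq_cycle_edges n) S \<longleftrightarrow>
      S \<in> indep3 {1..n} (adj n {1..n}) \<and> S \<inter> \<sigma> = {}" for S \<sigma>
    unfolding indep3_def by auto
  then show ?thesis unfolding total_cut_complex_def cut_cx_def Bex_def by simp
qed

text \<open>Cyclic distance \<open>1\<close> or \<open>2\<close>.\<close>

definition near :: "nat \<Rightarrow> nat \<Rightarrow> nat \<Rightarrow> bool" where
  "near n x y \<longleftrightarrow> x \<noteq> y \<and> (x \<le> y + 2 \<and> y \<le> x + 2 \<or> y + n \<le> x + 2 \<or> x + n \<le> y + 2)"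

lemma adj_sym: "adj n J x y \<Longrightarrow> adj n J y x"
  by (auto simp: adj_def cyc_def insert_commute)

lemma adj_imp_near:
  assumes n: "n \<ge> 5" and J: "J \<subseteq> {1..n}" and adj: "adj n J x y"
  shows "near n x y"
proof -
  consider "cyc n x y" | j where "j \<in> J" "{x, y} = {cpred n j, csucc n j}"
    using adj by (auto simp: adj_def)
  then show ?thesis
  proof cases
    case 1
    then show ?thesis using n by (auto simp: near_def cyc_def)
  next
    case (2 j)
    have j: "1 \<le> j" "j \<le> n" using 2(1) J by auto
    have "near n (cpred n j) (csucc n j)" "near n (csucc n j) (cpred n j)"
      using j n by (auto simp: near_def cpred_def csucc_eq)
    then show ?thesis using 2(2) by (auto simp: doubleton_eq_iff)
  qed
qed

text \<open>Across the wrap-around, the pairs other than the cycle edge \<open>{1, n}\<close> are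
  the chords with midpoint \<open>1\<close> or \<open>n\<close>.\<close>

lemma near_imp_adj:
  assumes xy: "x \<in> {1..n}" "y \<in> {1..n}" and n: "n \<ge> 5" and near: "near n x y"
  shows "adj n {1..n} x y"
proof -
  have *: "adj n {1..n} x y" if "j \<in> {1..n}" "{x, y} = {cpred n j, csucc n j}" for j
    using that by (auto simp: adj_def)
  have bnd: "1 \<le> x" "x \<le> n" "1 \<le> y" "y \<le> n" using xy by auto
  consider "cyc n x y" | "y = x + 2" | "x = y + 2" | "y + n \<le> x + 2" | "x + n \<le> y + 2"
    using near unfolding near_def cyc_def by linarith
  then show ?thesis
  proof cases
    case 1
    then show ?thesis by (simp add: adj_def)
  next
    case 2
    then show ?thesis using *[of "Suc x"] bnd n by (simp add: cpred_def csucc_eq)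
  next
    case 3
    then show ?thesis using *[of "Suc y"] bnd n by (simp add: cpred_def csucc_eq insert_commute)
  next
    case 4
    then consider "y = 1" "x = n" | "y = 1" "x = n - 1" | "y = 2" "x = n" using bnd by linarith
    then show ?thesis
      using *[of 1] *[of n] n
      by cases (auto simp: adj_def cyc_def cpred_def csucc_eq insert_commute)
  next
    case 5
    then consider "x = 1" "y = n" | "x = 1" "y = n - 1" | "x = 2" "y = n" using bnd by linarith
    then show ?thesis
      using *[of 1] *[of n] n
      by cases (auto simp: adj_def cyc_def cpred_def csucc_eq insert_commute)
  qed
qed

section \<open>Short paths in the squared cycle as congruences modulo n\<close>

text \<open>Expressing nearness by a signed step modulo \<open>n\<close> lets the steps of a path be
  added without tracking the wrap-around.\<close>

lemma near_dvd:
  assumes "x \<in> {1..n}" "y \<in> {1..n}" "near n x y"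
  obtains d where "d \<in> {-2, -1, 1, 2 :: int}" "int n dvd int y - int x - d"
proof -
  have bnd: "1 \<le> x" "x \<le> n" "1 \<le> y" "y \<le> n" using assms by auto
  consider "x \<noteq> y" "x \<le> y + 2" "y \<le> x + 2" | "y + n \<le> x + 2" | "x + n \<le> y + 2"
    using assms(3) unfolding near_def by blast
  then show thesis
  proof cases
    case 1
    then have "int y - int x \<in> {-2, -1, 1, 2}" by auto
    then show thesis by (rule that) simp
  next
    case 2
    then have "int y - int x + int n \<in> {-2, -1, 1, 2}" using bnd by auto
    then show thesis by (rule that) simp
  next
    case 3
    then have "int y - int x - int n \<in> {-2, -1, 1, 2}" using bnd by auto
    then show thesis by (rule that) simp
  qed
qed

lemma small_dvd_imp_0: "\<bar>d\<bar> < int n \<Longrightarrow> int n dvd d \<Longrightarrow> d = 0"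
  using dvd_imp_le_int[of d "int n"] by linarith

lemma dvd_imp_eq:
  assumes "x \<in> {1..n}" "y \<in> {1..n}" "int n dvd int y - int x"
  shows "y = x"
proof -
  have "1 \<le> x" "x \<le> n" "1 \<le> y" "y \<le> n" using assms by auto
  then have "\<bar>int y - int x\<bar> < int n" by linarith
  from small_dvd_imp_0[OF this assms(3)] show ?thesis by simp
qed

lemma dvd_imp_cyc:
  assumes "n \<ge> 3" "x \<in> {1..n}" "y \<in> {1..n}" "int n dvd int y - int x - d" "d \<in> {1, -1}"
  shows "cyc n x y"
proof -
  have bnd: "1 \<le> x" "x \<le> n" "1 \<le> y" "y \<le> n" using assms(2,3) by auto
  \<comment> \<open>Only in the first two cases can \<open>y - x - d\<close> reach \<open>-n\<close>
    or \<open>n\<close>.\<close>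
  consider "y = 1" "x = n" | "y = n" "x = 1" | "x < n \<or> 1 < y" "y < n \<or> 1 < x"
    using bnd by linarith
  then show ?thesis
  proof cases
    case 3
    then have "\<bar>int y - int x - d\<bar> < int n" using assms(5) bnd by auto
    from small_dvd_imp_0[OF this assms(4)] show ?thesis
      using assms(5) by (auto simp: cyc_def)
  qed (auto simp: cyc_def)
qed

lemma csucc_dvd: "w \<in> {1..n} \<Longrightarrow> int n dvd int (csucc n w) - int w - 1"
  by (auto simp: csucc_eq)

lemma cpred_dvd: "w \<in> {1..n} \<Longrightarrow> int n dvd int (cpred n w) - int w + 1"
  by (auto simp: cpred_def)

lemma cpred_csucc_range: "w \<in> {1..n} \<Longrightarrow> cpred n w \<in> {1..n}" "w \<in> {1..n} \<Longrightarrow> csucc n w \<in> {1..n}"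
  by (auto simp: cpred_def csucc_eq)

text \<open>Modulo \<open>n\<close>, \<open>z\<close> is both \<open>w - 1 + d\<^sub>1\<close> and
  \<open>w + 1 + d\<^sub>2\<close>. Since \<open>2 - d\<^sub>1 + d\<^sub>2\<close> is at most 6 in
  absolute value, it is 0, and among the allowed steps only \<open>d\<^sub>1 = 1\<close>,
  \<open>d\<^sub>2 = -1\<close> remains.\<close>

lemma sq_cycle_common_neighbour:
  assumes n: "n \<ge> 11" and w: "w \<in> {1..n}" and z: "z \<in> {1..n}"
    and near: "near n (cpred n w) z" "near n (csucc n w) z"
  shows "z = w"
proof -
  from near_dvd[OF cpred_csucc_range(1)[OF w] z near(1)] obtain d\<^sub>1 where
    d1: "d\<^sub>1 \<in> {-2, -1, 1, 2}" "int n dvd int z - int (cpred n w) - d\<^sub>1" .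
  from near_dvd[OF cpred_csucc_range(2)[OF w] z near(2)] obtain d\<^sub>2 where
    d2: "d\<^sub>2 \<in> {-2, -1, 1, 2}" "int n dvd int z - int (csucc n w) - d\<^sub>2" .
  have 1: "int n dvd int z - int w + 1 - d\<^sub>1"
    using dvd_add[OF d1(2) cpred_dvd[OF w]] by (simp add: algebra_simps)
  have 2: "int n dvd int z - int w - 1 - d\<^sub>2"
    using dvd_add[OF d2(2) csucc_dvd[OF w]] by (simp add: algebra_simps)
  have "int n dvd 2 - d\<^sub>1 + d\<^sub>2"
    using dvd_diff[OF 1 2] by (simp add: algebra_simps)
  moreover have "\<bar>2 - d\<^sub>1 + d\<^sub>2\<bar> < int n" using n d1(1) d2(1) by auto
  ultimately have "2 - d\<^sub>1 + d\<^sub>2 = 0" by (rule small_dvd_imp_0[rotated])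
  then have "d\<^sub>1 = 1" using d1(1) d2(1) by auto
  then show ?thesis using 1 dvd_imp_eq[OF w z] by simp
qed

text \<open>Modulo \<open>n\<close>, \<open>x\<close> is \<open>w + 2\<close> or
  \<open>w + 3\<close>, and \<open>y\<close> is \<open>w - 2\<close> or \<open>w - 3\<close>. The
  two resulting expressions for \<open>c\<close> differ by a number from 0 to 10, which
  \<open>n \<ge> 11\<close> forces to be 0; this is the case \<open>x = w + 2\<close>,
  \<open>y = w - 2\<close>, \<open>c = w\<close>. For \<open>n = 10\<close>,
  \<open>c = w + 5\<close> would also be possible.\<close>

lemma sq_cycle_path:
  assumes n: "n \<ge> 11" and w: "w \<in> {1..n}" and x: "x \<in> {1..n}" and y: "y \<in> {1..n}" and c: "c \<in> {1..n}"
    and near: "near n (csucc n w) x" "near n (cpred n w) y" "near n x c" "near n y c"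
    and far: "\<not> cyc n w x" "\<not> cyc n w y" "x \<noteq> w" "y \<noteq> w"
  shows "c = w"
proof -
  from near_dvd[OF cpred_csucc_range(2)[OF w] x near(1)] obtain d\<^sub>1 where
    d1: "d\<^sub>1 \<in> {-2, -1, 1, 2}" "int n dvd int x - int (csucc n w) - d\<^sub>1" .
  from near_dvd[OF cpred_csucc_range(1)[OF w] y near(2)] obtain d\<^sub>2 where
    d2: "d\<^sub>2 \<in> {-2, -1, 1, 2}" "int n dvd int y - int (cpred n w) - d\<^sub>2" .
  from near_dvd[OF x c near(3)] obtain d\<^sub>3 where
    d3: "d\<^sub>3 \<in> {-2, -1, 1, 2}" "int n dvd int c - int x - d\<^sub>3" .
  from near_dvd[OF y c near(4)] obtain d\<^sub>4 where
    d4: "d\<^sub>4 \<in> {-2, -1, 1, 2}" "int n dvd int c - int y - d\<^sub>4" .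
  have 1: "int n dvd int x - int w - (1 + d\<^sub>1)"
    using dvd_add[OF d1(2) csucc_dvd[OF w]] by (simp add: algebra_simps)
  have 2: "int n dvd int y - int w - (d\<^sub>2 - 1)"
    using dvd_add[OF d2(2) cpred_dvd[OF w]] by (simp add: algebra_simps)
  have 3: "int n dvd int c - int w - (1 + d\<^sub>1 + d\<^sub>3)"
    using dvd_add[OF 1 d3(2)] by (simp add: algebra_simps)
  have 4: "int n dvd int c - int w - (d\<^sub>2 - 1 + d\<^sub>4)"
    using dvd_add[OF 2 d4(2)] by (simp add: algebra_simps)
  have "1 + d\<^sub>1 \<noteq> 0" "1 + d\<^sub>1 \<noteq> -1"
    using 1 dvd_imp_eq[OF w x] dvd_imp_cyc[OF _ w x, of "1 + d\<^sub>1"] far n by auto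
  then have r1: "d\<^sub>1 \<in> {1, 2}" using d1(1) by auto
  have "d\<^sub>2 - 1 \<noteq> 0" "d\<^sub>2 - 1 \<noteq> 1"
    using 2 dvd_imp_eq[OF w y] dvd_imp_cyc[OF _ w y, of "d\<^sub>2 - 1"] far n by auto
  then have r2: "d\<^sub>2 \<in> {-1, -2}" using d2(1) by auto
  have "int n dvd 2 + d\<^sub>1 + d\<^sub>3 - d\<^sub>2 - d\<^sub>4"
    using dvd_diff[OF 4 3] by (simp add: algebra_simps)
  moreover have "\<bar>2 + d\<^sub>1 + d\<^sub>3 - d\<^sub>2 - d\<^sub>4\<bar> < int n"
    using n r1 r2 d3(1) d4(1) by auto
  ultimately have "2 + d\<^sub>1 + d\<^sub>3 - d\<^sub>2 - d\<^sub>4 = 0" by (rule small_dvd_imp_0[rotated])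
  moreover have "1 \<le> d\<^sub>1" "d\<^sub>2 \<le> -1" "-2 \<le> d\<^sub>3" "d\<^sub>4 \<le> 2" using r1 r2 d3(1) d4(1) by auto
  ultimately have "1 + d\<^sub>1 + d\<^sub>3 = 0" by linarith
  then show ?thesis using 3 dvd_imp_eq[OF w c] by simp
qed

text \<open>Every intermediate graph contains the cycle and lies inside the squared cycle, so the
  conditions of \<open>cut_cx_add_edge\<close> follow from the two preceding lemmas: a
  \<open>c\<close> as in \<open>path\<close> is the midpoint \<open>w\<close>, a neighbour of both
  ends of the chord.\<close>

lemma sq_cycle_to_cycle:
  assumes "n \<ge> 11" "J \<subseteq> {1..n}"
  shows "geom_realization (cut_cx {1..n} (indep3 {1..n} (cyc n))) homotopy_equivalent_space
         geom_realization (cut_cx {1..n} (indep3 {1..n} (adj n J)))"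
proof -
  have "finite J" using assms(2) finite_subset by blast
  then show ?thesis using assms(2)
  proof (induction J rule: finite_induct)
    case empty
    have "adj n {} = cyc n" by (auto simp: adj_def fun_eq_iff)
    then show ?case by (simp add: homotopy_equivalent_space_refl)
  next
    case (insert w J)
    let ?a = "cpred n w" and ?b = "csucc n w"
    have w: "w \<in> {1..n}" and J: "J \<subseteq> {1..n}" using insert.prems by auto
    have near: "near n x y" if "adj n J x y" for x y
      using adj_imp_near[OF _ J that] assms(1) by simp
    have cyc: "adj n J x y" if "cyc n x y" for x y using that by (simp add: adj_def)
    have wa: "cyc n w ?a" "cyc n w ?b"
      using w assms(1) by (auto simp: cyc_def cpred_def csucc_eq)
    have "geom_realization (cut_cx {1..n} (indep3 {1..n} (adj n J) \<union> {})) homotopy_equivalent_space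
          geom_realization (cut_cx {1..n} (indep3 {1..n} (with_edge ?a ?b (adj n J)) \<union> {}))"
    proof (rule cut_cx_add_edge)
      show "?a \<in> {1..n}" "?b \<in> {1..n}" "w \<in> {1..n}" "?a \<noteq> ?b"
        using w assms(1) by (auto simp: cpred_def csucc_eq)
      show "adj n J w ?a" "adj n J w ?b" using cyc wa by auto
      show "\<not> adj n J x x" for x using near by (auto simp: near_def)
      show "indep3 {1..n} (with_edge ?a ?b (adj n J)) \<union> {} \<noteq> {}"
      proof -
        \<comment> \<open>The triple \<open>{1, 4, 7}\<close> has cyclic gaps of at least 3, so no
          choice of chords destroys it.\<close>
        have "\<not> adj n (insert w J) x y" if "x \<in> {1, 4, 7}" "y \<in> {1, 4, 7}" for x y
          using adj_imp_near[OF _ insert.prems, of x y] assms(1) that by (auto simp: near_def)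
        then have "{1, 4, 7} \<in> indep3 {1..n} (with_edge ?a ?b (adj n J))"
          unfolding adj_insert[symmetric] indep3_def using assms(1) by auto
        then show ?thesis by blast
      qed
      show "adj n J w z" if "z \<in> {1..n}" "adj n J ?a z" "adj n J ?b z" "z \<noteq> w" for z
        using sq_cycle_common_neighbour[OF assms(1) w that(1) near near] that by blast
      show "adj n J ?a c \<or> adj n J ?b c"
        if "x \<in> {1..n}" "y \<in> {1..n}" "c \<in> {1..n}" "adj n J ?b x" "adj n J ?a y"
          "\<not> adj n J w x" "\<not> adj n J w y" "x \<noteq> w" "y \<noteq> w" "adj n J x c" "adj n J y c" for x y c
      proof -
        have "c = w"
          using sq_cycle_path[OF assms(1) w that(1-3) near[OF that(4)] near[OF that(5)]
              near[OF that(10)] near[OF that(11)]] that(6-9) cyc by blast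
        then show ?thesis using adj_sym cyc wa by blast
      qed
    qed (auto intro: adj_sym)
    then show ?case
      using insert.IH[OF J] homotopy_eqv_trans unfolding adj_insert by auto
  qed
qed

section \<open>Shortening the cycle down to six vertices\<close>

abbreviation singles :: "nat \<Rightarrow> nat \<Rightarrow> nat set set" where
  "singles m n \<equiv> (\<lambda>k. {k}) ` {m<..n}"

text \<open>With the chord from \<open>m - 1\<close> to \<open>1\<close> added, \<open>m - 1\<close> dominates \<open>m\<close>. A singleton hyperedge \<open>{m}\<close>
  amounts to a suspension with respect to the vertex \<open>m\<close>.\<close>

lemma cycle_step:
  assumes m: "7 \<le> m" "m \<le> n"
  shows "geom_realization (cut_cx {1..n} (indep3 {1..m} (cyc m) \<union> singles m n)) homotopy_equivalent_space
         geom_realization (cut_cx {1..n} (indep3 {1..m - 1} (cyc (m - 1)) \<union> singles (m - 1) n))"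
proof -
  let ?B = "with_edge (m - 1) 1 (cyc m)"
  let ?H = "indep3 {1..m} ?B \<union> singles m n"
  have "{2, 4, 6} \<in> indep3 {1..m} ?B"
    using m by (auto simp: indep3_def with_edge_def cyc_def)
  then have ne: "?H \<noteq> {}" by blast
  have "geom_realization (cut_cx {1..n} (indep3 {1..m} (cyc m) \<union> singles m n)) homotopy_equivalent_space
        geom_realization (cut_cx {1..n} ?H)"
  \<comment> \<open>Here \<open>a = m - 1\<close> and \<open>b = 1\<close>. In \<open>path\<close>,
    \<open>x = 2\<close> and \<open>y = m - 2\<close>, which have no common neighbour for
    \<open>m \<ge> 7\<close>; for \<open>m = 6\<close> they share \<open>3\<close>, so the
    shortening stops at six vertices.\<close>
  proof (rule cut_cx_add_edge[where w = m])
    show "?H \<noteq> {}" by (rule ne)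
  qed (use m in \<open>auto simp: cyc_def\<close>)
  also have "geom_realization (cut_cx {1..n} ?H) homotopy_equivalent_space
        geom_realization (cut_cx {1..n} (insert {m} ?H))"
  proof (subst homotopy_equivalent_space_sym, rule cut_cx_insert)
    show "m - 1 \<in> {1..n}" "m - 1 \<notin> {m}" using m by auto
    show "\<exists>f\<in>?H. f \<subseteq> {m} \<union> (e - {m - 1})" if e0: "e \<in> ?H" "m - 1 \<in> e" for e
    proof -
      have "e \<in> indep3 {1..m} ?B" using e0 m by auto
      from indep3_E[OF this e0(2)] obtain x y where e: "e = {m - 1, x, y}" "m - 1 \<noteq> x" "m - 1 \<noteq> y" "x \<noteq> y"
        "x \<in> {1..m}" "y \<in> {1..m}" "\<not> ?B (m - 1) x" "\<not> ?B (m - 1) y" "\<not> ?B x y" "\<not> ?B y x"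
        by metis
      have xy: "x \<noteq> 1" "x \<noteq> m" "y \<noteq> 1" "y \<noteq> m"
        using e m by (auto simp: with_edge_def cyc_def)
      \<comment> \<open>The neighbours of \<open>m\<close> are \<open>m - 1\<close> and
        \<open>1\<close>, and the chord keeps \<open>1\<close> out of \<open>e\<close>; so
        \<open>m\<close> can take the place of \<open>m - 1\<close>.\<close>
      have "{m, x, y} \<in> indep3 {1..m} ?B"
        using e xy m by (auto simp: indep3_def with_edge_def cyc_def)
      moreover have "{m, x, y} \<subseteq> {m} \<union> (e - {m - 1})" using e by auto
      ultimately show ?thesis by blast
    qed
  qed (use ne in auto)
  also have "cut_cx {1..n} (insert {m} ?H) = cut_cx {1..n} (indep3 {1..m - 1} (cyc (m - 1)) \<union> singles (m - 1) n)"
  proof (rule cut_cx_cong)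
    \<comment> \<open>The chord closes the path on \<open>{1..m - 1}\<close> to a cycle, and
      \<open>{m}\<close> absorbs every triple through \<open>m\<close>.\<close>
    have Beq: "?B x y \<longleftrightarrow> cyc (m - 1) x y" if "x \<in> {1..m - 1}" "y \<in> {1..m - 1}" for x y
      using that m by (auto simp: with_edge_def cyc_def)
    have I: "indep3 {1..m - 1} (cyc (m - 1)) = {S \<in> indep3 {1..m} ?B. m \<notin> S}"
    proof (intro set_eqI)
      fix S
      have "{1..m - 1} = {1..m} - {m}" by auto
      then have "S \<subseteq> {1..m - 1} \<longleftrightarrow> S \<subseteq> {1..m} \<and> m \<notin> S" by auto
      then show "S \<in> indep3 {1..m - 1} (cyc (m - 1)) \<longleftrightarrow> S \<in> {S \<in> indep3 {1..m} ?B. m \<notin> S}"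
        unfolding indep3_def using Beq by (auto simp: subset_iff)
    qed
    have s: "singles (m - 1) n = insert {m} (singles m n)"
    proof -
      have "{m - 1<..n} = insert m {m<..n}" using m by auto
      then show ?thesis by auto
    qed
    have sub: "indep3 {1..m - 1} (cyc (m - 1)) \<union> singles (m - 1) n \<subseteq> insert {m} ?H"
      unfolding I s by auto
    show "\<exists>h'\<in>insert {m} ?H. h' \<subseteq> h"
      if "h \<in> indep3 {1..m - 1} (cyc (m - 1)) \<union> singles (m - 1) n" for h
      using subsetD[OF sub that] by auto
    show "\<exists>h'\<in>indep3 {1..m - 1} (cyc (m - 1)) \<union> singles (m - 1) n. h' \<subseteq> h"
      if "h \<in> insert {m} ?H" for h
    proof (cases "m \<in> h")
      case True
      then show ?thesis unfolding s by (intro bexI[of _ "{m}"]) auto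
    next
      case False
      then have "h \<in> indep3 {1..m - 1} (cyc (m - 1)) \<union> singles (m - 1) n"
        using that unfolding I s by auto
      then show ?thesis by (intro bexI[of _ h]) auto
    qed
  qed
  finally show ?thesis .
qed

lemma card_3_sortedE:
  fixes S :: "nat set"
  assumes "card S = 3"
  obtains x y z where "x < y" "y < z" "S = {x, y, z}"
proof -
  obtain a b c where abc: "S = {a, b, c}" "a \<noteq> b" "a \<noteq> c" "b \<noteq> c"
    using assms by (auto simp: card_3_iff)
  then consider "a < b" "b < c" | "a < c" "c < b" | "b < a" "a < c" | "b < c" "c < a"
    | "c < a" "a < b" | "c < b" "b < a"
    by linarith
  then show thesis by cases (use that abc(1) in \<open>auto simp: insert_commute\<close>)
qed

lemma indep3_cycle6: "indep3 {1..6} (cyc 6) = {{1, 3, 5}, {2, 4, 6}}"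
proof (intro equalityI subsetI)
  fix S assume S: "S \<in> indep3 {1..6} (cyc 6)"
  then obtain x y z where xyz: "x < y" "y < z" "S = {x, y, z}"
    by (auto simp: indep3_def elim: card_3_sortedE)
  then have "\<not> cyc 6 x y" "\<not> cyc 6 y z" "\<not> cyc 6 x z" "1 \<le> x" "z \<le> 6"
    using S by (auto simp: indep3_def)
  then have "x + 2 \<le> y" "y + 2 \<le> z" "1 \<le> x" "z \<le> 6" "\<not> (x = 1 \<and> z = 6)"
    using xyz(1,2) unfolding cyc_def by auto
  then have "x = 1 \<and> y = 3 \<and> z = 5 \<or> x = 2 \<and> y = 4 \<and> z = 6"
    by linarith
  then show "S \<in> {{1, 3, 5}, {2, 4, 6}}" using xyz(3) by auto
qed (auto simp: indep3_def cyc_def)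

lemma cycle_homotopy_nsphere:
  assumes "6 \<le> m" "m \<le> n"
  shows "geom_realization (cut_cx {1..n} (indep3 {1..m} (cyc m) \<union> singles m n))
    homotopy_equivalent_space nsphere (n - 6)"
  using assms
proof (induction m rule: dec_induct)
  case base
  \<comment> \<open>Two triples and \<open>n - 6\<close> singletons: the block count
    \<open>p + 2\<close> of the partition lemma with \<open>p = n - 6\<close>.\<close>
  have "card ({{1, 3, 5}, {2, 4, 6}} \<union> singles 6 n) = card {{1, 3, 5}, {2, 4, 6 :: nat}} + card (singles 6 n)"
    by (intro card_Un_disjoint) auto
  also have "card {{1, 3, 5}, {2, 4, 6 :: nat}} = 2" by (simp add: card_insert_if set_eq_subset)
  also have "card (singles 6 n) = n - 6" by (subst card_image) (auto simp: inj_on_def)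
  finally have card: "card ({{1, 3, 5}, {2, 4, 6}} \<union> singles 6 n) = n - 6 + 2" by simp
  show ?case unfolding indep3_cycle6
  proof (rule cut_cx_partition_homotopy_nsphere[OF _ _ _ _ card])
    show "\<Union> ({{1, 3, 5}, {2, 4, 6}} \<union> singles 6 n) = {1..n}"
      using base by auto
    show "disjoint ({{1, 3, 5}, {2, 4, 6}} \<union> singles 6 n)"
      by (auto simp: disjoint_def)
  qed auto
next
  case (step m)
  have "geom_realization (cut_cx {1..n} (indep3 {1..Suc m} (cyc (Suc m)) \<union> singles (Suc m) n))
      homotopy_equivalent_space geom_realization (cut_cx {1..n} (indep3 {1..m} (cyc m) \<union> singles m n))"
    using cycle_step[of "Suc m" n] step.hyps step.prems by simp
  also have "\<dots> homotopy_equivalent_space nsphere (n - 6)"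
    using step.prems by (intro step.IH) simp
  finally show ?case .
qed

section \<open>The cases of nine and ten vertices\<close>

text \<open>Independence means that all three cyclic gaps are at least 3;
  \<open>z + 3 \<le> x + n\<close> is the gap across the wrap-around.\<close>

lemma indep3_sq_cycleE:
  assumes n: "n \<ge> 5" and S: "S \<in> indep3 {1..n} (adj n {1..n})"
  obtains x y z where "S = {x, y, z}" "1 \<le> x" "x + 3 \<le> y" "y + 3 \<le> z" "z \<le> n" "z + 3 \<le> x + n"
proof -
  obtain x y z where xyz: "x < y" "y < z" "S = {x, y, z}"
    using S by (auto simp: indep3_def elim: card_3_sortedE)
  then have "\<not> near n x y" "\<not> near n y z" "\<not> near n x z" "1 \<le> x" "z \<le> n"
    using S near_imp_adj[OF _ _ n] by (auto simp: indep3_def)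
  then have "x + 3 \<le> y" "y + 3 \<le> z" "z + 3 \<le> x + n"
    using xyz(1,2) unfolding near_def by linarith+
  then show thesis using that[of x y z] xyz \<open>1 \<le> x\<close> \<open>z \<le> n\<close> by blast
qed

lemma indep3_sq_cycleI:
  assumes n: "n \<ge> 5" and "1 \<le> x" "x + 3 \<le> y" "y + 3 \<le> z" "z \<le> n" "z + 3 \<le> x + n"
  shows "{x, y, z} \<in> indep3 {1..n} (adj n {1..n})"
proof -
  have "\<not> near n u v" if "u \<in> {x, y, z}" "v \<in> {x, y, z}" for u v
    using that assms by (auto simp: near_def)
  then have "\<not> adj n {1..n} u v" if "u \<in> {x, y, z}" "v \<in> {x, y, z}" for u v
    using adj_imp_near[OF n, of "{1..n}" u v] that by blast
  then show ?thesis using assms by (simp add: indep3_def)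
qed

text \<open>Three gaps of at least 3 with sum 9 all equal 3, so the independent triples are the
  residue classes modulo 3.\<close>

lemma sq_cycle9:
  "geom_realization (cut_cx {1..9} (indep3 {1..9} (adj 9 {1..9}))) homotopy_equivalent_space nsphere 1"
proof -
  have eq: "indep3 {1..9} (adj 9 {1..9}) = {{1, 4, 7}, {2, 5, 8}, {3, 6, 9}}"
  proof (intro equalityI subsetI)
    fix S assume S: "S \<in> indep3 {1..9} (adj 9 {1..9})"
    have "(5 :: nat) \<le> 9" by simp
    from indep3_sq_cycleE[OF this S] obtain x y z
      where xyz: "S = {x, y, z}" "1 \<le> x" "x + 3 \<le> y" "y + 3 \<le> z" "z \<le> 9" "z + 3 \<le> x + 9" .
    then have "x = 1 \<or> x = 2 \<or> x = 3" "y = x + 3" "z = x + 6" by linarith+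
    then show "S \<in> {{1, 4, 7}, {2, 5, 8}, {3, 6, 9}}"
      unfolding xyz(1) by (elim disjE) simp_all
  next
    fix S assume "S \<in> {{1, 4, 7}, {2, 5, 8}, {3, 6, 9 :: nat}}"
    then show "S \<in> indep3 {1..9} (adj 9 {1..9})"
      by (elim insertE emptyE; simp only:; intro indep3_sq_cycleI; simp)
  qed
  show ?thesis unfolding eq
  proof (rule cut_cx_partition_homotopy_nsphere)
    show "\<Union> {{1, 4, 7}, {2, 5, 8}, {3, 6, 9}} = {1..9 :: nat}"
      by (intro set_eqI, simp, presburger)
    show "disjoint {{1, 4, 7}, {2, 5, 8}, {3, 6, 9 :: nat}}" by (simp add: disjoint_def)
    show "card {{1, 4, 7}, {2, 5, 8}, {3, 6, 9 :: nat}} = 1 + 2"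
      by (simp add: card_insert_if set_eq_subset)
  qed auto
qed

lemma sq_cycle10:
  "geom_realization (cut_cx {1..10} (indep3 {1..10} (adj 10 {1..10}))) homotopy_equivalent_space nsphere 3"
proof -
  \<comment> \<open>In the cyclic order \<open>1, 4, 7, 10, 3, 6, 9, 2, 5, 8\<close> the independent triples are the triples of
    consecutive vertices; they are replaced by a partition into pairs of consecutive vertices. If \<open>h\<close>
    sits at positions \<open>0, 1\<close>, then \<open>w\<close>, \<open>g\<close> and \<open>w'\<close> sit at \<open>3\<close>, \<open>{4, 5}\<close> and \<open>7\<close>.\<close>
  define T where "T = {{1, 4, 7}, {4, 7, 10}, {7, 10, 3}, {10, 3, 6}, {3, 6, 9}, {6, 9, 2}, {9, 2, 5},
    {2, 5, 8}, {5, 8, 1}, {8, 1, 4 :: nat}}"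
  define P where "P = {{5, 8}, {9, 2}, {3, 6}, {7, 10}, {1, 4 :: nat}}"
  have T: "indep3 {1..10} (adj 10 {1..10}) = T"
  proof (intro equalityI subsetI)
    fix S assume S: "S \<in> indep3 {1..10} (adj 10 {1..10})"
    have "(5 :: nat) \<le> 10" by simp
    from indep3_sq_cycleE[OF this S] obtain x y z where xyz: "S = {x, y, z}" "1 \<le> x" "x + 3 \<le> y" "y + 3 \<le> z" "z \<le> 10" "z + 3 \<le> x + 10" .
    \<comment> \<open>The gaps sum to 10, so they are 3, 3 and 4 in some order.\<close>
    then have "x = 1 \<or> x = 2 \<or> x = 3 \<or> x = 4" "y = x + 3 \<and> (z = x + 6 \<or> z = x + 7) \<or> y = x + 4 \<and> z = x + 7"
      by linarith+
    then show "S \<in> T" using xyz(1,5) by (elim disjE conjE) (simp_all add: T_def insert_commute)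
  next
    fix S assume "S \<in> T"
    then have "S \<in> {{1, 4, 7}, {4, 7, 10}, {3, 7, 10}, {3, 6, 10}, {3, 6, 9}, {2, 6, 9}, {2, 5, 9},
      {2, 5, 8}, {1, 5, 8}, {1, 4, 8}}"
      by (simp add: T_def insert_commute)
    then show "S \<in> indep3 {1..10} (adj 10 {1..10})"
      by (elim insertE emptyE; simp only:; intro indep3_sq_cycleI; simp)
  qed
  \<comment> \<open>Of the triples through \<open>10\<close>, those containing \<open>7\<close> are
    replaced by \<open>{1, 4, 7}\<close>, and \<open>{10, 3, 6}\<close> by
    \<open>h \<union> g = {1, 4, 3, 6}\<close>. Each later insertion shifts all positions by
    2.\<close>
  have "geom_realization (cut_cx {1..10} T) homotopy_equivalent_space
      geom_realization (cut_cx {1..10} (insert {1, 4} T))"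
    by (rule cut_cx_insert2[where g = "{3, 6}" and w = 10 and w' = 2]) (auto simp: T_def)
  also have "geom_realization (cut_cx {1..10} (insert {1, 4} T)) homotopy_equivalent_space
      geom_realization (cut_cx {1..10} (insert {7, 10} (insert {1, 4} T)))"
    by (rule cut_cx_insert2[where g = "{9, 2}" and w = 6 and w' = 8]) (auto simp: T_def)
  also have "geom_realization (cut_cx {1..10} (insert {7, 10} (insert {1, 4} T))) homotopy_equivalent_space
      geom_realization (cut_cx {1..10} (insert {3, 6} (insert {7, 10} (insert {1, 4} T))))"
    by (rule cut_cx_insert2[where g = "{5, 8}" and w = 2 and w' = 4]) (auto simp: T_def)
  also have "geom_realization (cut_cx {1..10} (insert {3, 6} (insert {7, 10} (insert {1, 4} T))))
      homotopy_equivalent_space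
      geom_realization (cut_cx {1..10} (insert {9, 2} (insert {3, 6} (insert {7, 10} (insert {1, 4} T)))))"
    by (rule cut_cx_insert2[where g = "{1, 4}" and w = 8 and w' = 10]) (auto simp: T_def)
  also have "geom_realization (cut_cx {1..10} (insert {9, 2} (insert {3, 6} (insert {7, 10} (insert {1, 4} T)))))
      homotopy_equivalent_space
      geom_realization (cut_cx {1..10} (insert {5, 8} (insert {9, 2} (insert {3, 6} (insert {7, 10} (insert {1, 4} T))))))"
    by (rule cut_cx_insert2[where g = "{7, 10}" and w = 4 and w' = 6]) (auto simp: T_def)
  also have "cut_cx {1..10} (insert {5, 8} (insert {9, 2} (insert {3, 6} (insert {7, 10} (insert {1, 4} T))))) =
      cut_cx {1..10} P"
  proof (rule cut_cx_cong)
    \<comment> \<open>Three consecutive positions always include both members of one of the five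
      pairs.\<close>
    have "\<exists>h'\<in>P. h' \<subseteq> h" if "h \<in> T" for h
      using that unfolding T_def by (elim insertE emptyE) (simp_all add: P_def)
    then show "\<exists>h'\<in>P. h' \<subseteq> h"
      if "h \<in> insert {5, 8} (insert {9, 2} (insert {3, 6} (insert {7, 10} (insert {1, 4} T))))" for h
      using that by (auto simp: P_def)
    show "\<exists>h'\<in>insert {5, 8} (insert {9, 2} (insert {3, 6} (insert {7, 10} (insert {1, 4} T)))). h' \<subseteq> h"
      if "h \<in> P" for h
      using that unfolding P_def by blast
  qed
  also have "geom_realization (cut_cx {1..10} P) homotopy_equivalent_space nsphere 3"
  proof (rule cut_cx_partition_homotopy_nsphere)
    show "\<Union> P = {1..10}" unfolding P_def by (intro set_eqI, simp, presburger)
    show "disjoint P" by (simp add: P_def disjoint_def)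
    show "card P = 3 + 2" by (simp add: P_def card_insert_if set_eq_subset)
  qed (auto simp: P_def)
  finally show ?thesis by (simp only: T)
qed

theorem theorem3p2:
  fixes n :: nat
  assumes "n \<ge> 9"
  shows "geom_realization (total_cut_complex 3 {1..n} (sq_cycle_edges n))
           homotopy_equivalent_space
         nsphere (if n \<le> 10 then 2 * n - 17 else n - 6)"
proof -
  have eq: "total_cut_complex 3 {1..n} (sq_cycle_edges n) = cut_cx {1..n} (indep3 {1..n} (adj n {1..n}))"
    using assms by (intro total_cut_complex_sq_cycle) simp
  consider "n = 9" | "n = 10" | "n \<ge> 11" using assms by linarith
  then show ?thesis
  proof cases
    case 1
    then show ?thesis unfolding eq using sq_cycle9 by simp
  next
    case 2
    then show ?thesis unfolding eq using sq_cycle10 by simp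
  next
    case 3
    have "geom_realization (cut_cx {1..n} (indep3 {1..n} (adj n {1..n}))) homotopy_equivalent_space
          geom_realization (cut_cx {1..n} (indep3 {1..n} (cyc n)))"
      by (subst homotopy_equivalent_space_sym, rule sq_cycle_to_cycle[OF 3 subset_refl])
    also have "\<dots> homotopy_equivalent_space nsphere (n - 6)"
      using cycle_homotopy_nsphere[of n n] 3 by simp
    finally show ?thesis unfolding eq using 3 by simp
  qed
qed

end
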